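(* Let $d\ge1$ and let $\Sigma'\subset\mathbb{C}^{2d}$ be the set of right-hand sides for which the Prony problem of order $d$ is unsolvable. As the right-hand side $\mu\in\mathbb{C}^{2d}\setminus\Sigma'$ approaches a finite point $\mu_0\in\Sigma'$, at least one of the nodes in the solution of the Prony problem with right-hand side $\mu$ tends to infinity; that is, the maximum of the absolute values of the nodes of the solution tends to $\infty$ as $\mu\to\mu_0$, $\mu\in\mathbb{C}^{2d}\setminus\Sigma'$.
   Context: Prony problem of order $d$ with right-hand side $\mu=(m_0,\dots,m_{2d-1})\in\mathbb{C}^{2d}$: find a number $s$, a multiplicity vector $D=(d_1,\dots,d_s)$ of positive integers with $\sum_{j=1}^s d_j\le d$, pairwise distinct nodes $x_1,\dots,x_s\in\mathbb{C}$, and coefficients $a_{j,\ell}\in\mathbb{C}$ ($1\le j\le s$, $0\le \ell\le d_j-1$) with $a_{j,d_j-1}\ne 0$ for every $j$, such that $$\sum_{j=1}^{s}\sum_{\ell=0}^{d_j-1}\frac{k!}{(k-\ell)!}\,a_{j,\ell}\,x_j^{k-\ell}=m_k,\qquad k=0,1,\dots,2d-1,$$ where terms with $\ell>k$ are read as $0$ and $x^0=1$ (for $\mu=0$ the empty solution $s=0$ is allowed). The problem is solvable for $\mu$ if such data exist, and unsolvable otherwise; when it is solvable, the solution is unique up to a permutation of the nodes. *)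

theory Defs
  imports "HOL-Analysis.Analysis"
begin

text \<open>
  The space of right-hand sides \<open>(m\<^sub>0, \<dots>, m\<^bsub>2d-1\<^esub>)\<close>, i.e. complex \<open>2d\<close>-space. The dimension is a
  term, so vectors are functions that are \<open>undefined\<close> off \<open>{..<2 * d}\<close>. The product topology
  on \<open>nat \<Rightarrow> complex\<close> induces on this set the usual Euclidean topology.
\<close>

definition prony_rhs :: "nat \<Rightarrow> (nat \<Rightarrow> complex) set" where
  "prony_rhs d = (\<Pi>\<^sub>E k\<in>{..<2 * d}. UNIV)"

definition prony_moment ::
  "nat \<Rightarrow> (nat \<Rightarrow> nat) \<Rightarrow> (nat \<Rightarrow> complex) \<Rightarrow> (nat \<Rightarrow> nat \<Rightarrow> complex) \<Rightarrow> nat \<Rightarrow> complex" where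
  "prony_moment s D x a k =
     (\<Sum>j=1..s. \<Sum>l<D j.
        if l \<le> k then fact k / fact (k - l) * a j l * x j ^ (k - l) else 0)"

definition prony_solution ::
  "nat \<Rightarrow> (nat \<Rightarrow> complex) \<Rightarrow> nat \<Rightarrow> (nat \<Rightarrow> nat) \<Rightarrow> (nat \<Rightarrow> complex)
     \<Rightarrow> (nat \<Rightarrow> nat \<Rightarrow> complex) \<Rightarrow> bool" where
  "prony_solution d \<mu> s D x a \<longleftrightarrow>
     (\<forall>j\<in>{1..s}. D j > 0) \<and>
     (\<Sum>j=1..s. D j) \<le> d \<and>
     inj_on x {1..s} \<and>
     (\<forall>j\<in>{1..s}. a j (D j - 1) \<noteq> 0) \<and>
     (\<forall>k<2 * d. prony_moment s D x a k = \<mu> k)"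

definition prony_solvable :: "nat \<Rightarrow> (nat \<Rightarrow> complex) \<Rightarrow> bool" where
  "prony_solvable d \<mu> \<longleftrightarrow> (\<exists>s D x a. prony_solution d \<mu> s D x a)"

definition prony_unsolvable_set :: "nat \<Rightarrow> (nat \<Rightarrow> complex) set" where
  "prony_unsolvable_set d = {\<mu> \<in> prony_rhs d. \<not> prony_solvable d \<mu>}"

text \<open>
  The inserted \<open>0\<close> matters only for the empty solution (\<open>s = 0\<close>), where it fixes the value \<open>0\<close>.
\<close>

definition max_node_norm :: "nat \<Rightarrow> (nat \<Rightarrow> complex) \<Rightarrow> real" where
  "max_node_norm s x = Max (insert 0 ((\<lambda>j. norm (x j)) ` {1..s}))"

text \<open>
  \<open>R\<close> maps each solvable right-hand side to the largest modulus of a node of its solution.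
  Solutions are unique only up to a permutation of the nodes (and up to irrelevant
  values outside the index ranges), hence a predicate on \<open>R\<close> rather than a function.
\<close>

definition is_prony_max_node_norm :: "nat \<Rightarrow> ((nat \<Rightarrow> complex) \<Rightarrow> real) \<Rightarrow> bool" where
  "is_prony_max_node_norm d R \<longleftrightarrow>
     (\<forall>\<mu> \<in> prony_rhs d - prony_unsolvable_set d.
        \<exists>s D x a. prony_solution d \<mu> s D x a \<and> R \<mu> = max_node_norm s x)"

end

theory Submission
  imports Defs
begin

text \<open>
  The theorem is a compactness statement about linear recurrences. Let \<open>E\<close> be the shift on
  sequences, so that the operator \<open>E - z\<close> maps \<open>m\<close> to \<open>k \<mapsto> m (k + 1) - z m k\<close>. The contribution of
  a node \<open>x\<close> of multiplicity \<open>n\<close> to the moments is a combination of the derivatives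
  \<open>(d/dx)\<^sup>l x\<^sup>k\<close> with \<open>l < n\<close>, and \<open>(E - x)\<^sup>n\<close> kills it. Hence the Prony problem with right-hand side
  \<open>\<mu>\<close> is solvable if and only if there are \<open>d\<close> complex numbers \<open>z\<^sub>1, \<dots>, z\<^sub>d\<close>, repetitions allowed, with
  \<open>((E - z\<^sub>1) \<cdots> (E - z\<^sub>d) \<mu>) k = 0\<close> for all \<open>k < d\<close>; these are all the conditions that involve only
  the \<open>2d\<close> given entries of \<open>\<mu>\<close>.

  If a solution is given, the \<open>z\<^sub>i\<close> are its nodes, repeated according to multiplicity and
  padded with zeros to length \<open>d\<close> (\<open>prony_solution_annihilated\<close>). In the other direction,
  solving the first-order recurrences one after the other writes \<open>\<mu>\<close> as a combination of the
  derivatives above, and dropping vanishing leading coefficients yields a solution in which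
  multiplicities are exact (\<open>prony_solvable_if_annihilated\<close>).

  The point of this reformulation is that it does not see collisions of nodes or vanishing
  coefficients: it is a closed condition on \<open>(\<mu>, z\<^sub>1, \<dots>, z\<^sub>d)\<close>. Suppose that the largest node modulus
  does not tend to infinity. Then there are solvable \<open>\<mu>\<^sub>n\<close> tending to \<open>\<mu>\<^sub>0\<close> whose nodes stay in a
  fixed disc. A subsequence of the tuples \<open>z\<close> converges, the limit satisfies the same condition
  for \<open>\<mu>\<^sub>0\<close>, and \<open>\<mu>\<^sub>0\<close> is solvable (\<open>limit_of_bounded_nodes_solvable\<close>), a contradiction.
\<close>

section \<open>Derivatives of powers and difference operators\<close>

text \<open>
  The \<open>l\<close>-th derivative of \<open>x\<^sup>k\<close> with respect to \<open>x\<close>, as a sequence in \<open>k\<close>. The binomial coefficient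
  gives the value \<open>0\<close> for \<open>l > k\<close> without a case distinction.
\<close>

definition power_deriv :: "nat \<Rightarrow> complex \<Rightarrow> nat \<Rightarrow> complex" where
  "power_deriv l x k = of_nat (fact l * (k choose l)) * x ^ (k - l)"

definition shift_minus :: "complex \<Rightarrow> (nat \<Rightarrow> complex) \<Rightarrow> nat \<Rightarrow> complex" where
  "shift_minus y m k = m (Suc k) - y * m k"

text \<open>
  With \<open>d\<close> entries in \<open>zs\<close>, these are the solutions of the recurrence of order \<open>d\<close> whose
  characteristic polynomial has the entries of \<open>zs\<close> as its roots.
\<close>

definition power_deriv_span :: "complex list \<Rightarrow> (nat \<Rightarrow> complex) set" where
  "power_deriv_span zs =
     {h. \<exists>a. \<forall>k. h k = (\<Sum>x\<in>set zs. \<Sum>l<count_list zs x. a x l * power_deriv l x k)}"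

lemma prony_moment_eq_sum_power_deriv:
  "prony_moment s D x a k = (\<Sum>j=1..s. \<Sum>l<D j. a j l * power_deriv l (x j) k)"
proof -
  have "(if l \<le> k then fact k / fact (k - l) * c * y ^ (k - l) else 0) = c * power_deriv l y k"
    for l and c y :: complex
  proof (cases "l \<le> k")
    case True
    then have "(of_nat (k choose l) :: complex) = fact k / (fact l * fact (k - l))"
      by (rule binomial_fact)
    with True show ?thesis by (simp add: power_deriv_def field_simps)
  qed (simp add: power_deriv_def)
  then show ?thesis by (simp add: prony_moment_def)
qed

text \<open>
  For \<open>y = x\<close> this is the \<open>l\<close>-th derivative of \<open>x\<^bsup>k+1\<^esup> = x \<cdot> x\<^sup>k\<close> by the Leibniz rule; in coefficients it
  is Pascal's rule. At \<open>l = 0\<close> the truncated \<open>l - 1\<close> is harmless because of the factor \<open>l\<close>.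
\<close>

lemma shift_minus_power_deriv:
  "shift_minus y (power_deriv l x) k
     = (x - y) * power_deriv l x k + of_nat l * power_deriv (l - 1) x k"
proof (cases l)
  case 0
  then show ?thesis by (simp add: shift_minus_def power_deriv_def algebra_simps)
next
  case (Suc n)
  show ?thesis
  proof (cases "k \<le> n")
    case True
    then show ?thesis
      by (cases "k = n")
        (simp_all add: Suc shift_minus_def power_deriv_def binomial_eq_0 algebra_simps)
  next
    case False
    then have "x ^ (k - n) = x * x ^ (k - Suc n)"
      by (metis Suc_diff_Suc not_le power_Suc)
    then show ?thesis
      by (simp add: Suc shift_minus_def power_deriv_def algebra_simps)
  qed
qed

lemma fold_shift_minus_lincomb:
  "fold shift_minus zs (\<lambda>k. \<Sum>i\<in>I. c i * h i k) k = (\<Sum>i\<in>I. c i * fold shift_minus zs (h i) k)"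
proof (induction zs arbitrary: h)
  case (Cons y zs)
  have "shift_minus y (\<lambda>k. \<Sum>i\<in>I. c i * h i k) = (\<lambda>k. \<Sum>i\<in>I. c i * shift_minus y (h i) k)"
    by (simp add: fun_eq_iff shift_minus_def sum_distrib_left sum_subtractf algebra_simps)
  then show ?case by (simp add: Cons.IH)
qed simp

lemma fold_shift_minus_add_scaled:
  "fold shift_minus zs (\<lambda>k. c * g k + e * h k) k
     = c * fold shift_minus zs g k + e * fold shift_minus zs h k"
proof -
  have "fold shift_minus zs (\<lambda>k. \<Sum>b\<in>UNIV. (if b then c else e) * (if b then g else h) k) k
      = (\<Sum>b\<in>UNIV. (if b then c else e) * fold shift_minus zs (if b then g else h) k)"
    by (rule fold_shift_minus_lincomb)
  then show ?thesis by (simp add: UNIV_bool add.commute)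
qed

text \<open>
  Each factor \<open>E - x\<close> lowers the order of the derivative by one, and the other factors do not
  raise it, so that more than \<open>l\<close> factors \<open>E - x\<close> leave nothing.
\<close>

lemma fold_shift_minus_power_deriv_eq_0:
  "l < count_list zs x \<Longrightarrow> fold shift_minus zs (power_deriv l x) k = 0"
proof (induction zs arbitrary: l)
  case (Cons y zs)
  have "shift_minus y (power_deriv l x)
      = (\<lambda>k. (x - y) * power_deriv l x k + of_nat l * power_deriv (l - 1) x k)"
    by (rule ext) (rule shift_minus_power_deriv)
  then have "fold shift_minus (y # zs) (power_deriv l x) k
      = (x - y) * fold shift_minus zs (power_deriv l x) k
        + of_nat l * fold shift_minus zs (power_deriv (l - 1) x) k"
    by (simp add: fold_shift_minus_add_scaled)
  moreover have "x = y \<or> fold shift_minus zs (power_deriv l x) k = 0"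
    using Cons.IH[of l] Cons.prems by (auto split: if_splits)
  moreover have "l = 0 \<or> fold shift_minus zs (power_deriv (l - 1) x) k = 0"
    using Cons.IH[of "l - 1"] Cons.prems by (cases l) (auto split: if_splits)
  ultimately show ?case by auto
qed simp

section \<open>Solving the recurrence\<close>

lemma power_deriv_span_lincomb:
  assumes "\<And>i. i \<in> I \<Longrightarrow> h i \<in> power_deriv_span zs"
  shows "(\<lambda>k. \<Sum>i\<in>I. c i * h i k) \<in> power_deriv_span zs"
proof -
  have "\<forall>i. \<exists>a. i \<in> I \<longrightarrow>
      (\<forall>k. h i k = (\<Sum>x\<in>set zs. \<Sum>l<count_list zs x. a x l * power_deriv l x k))"
    using assms by (auto simp: power_deriv_span_def)
  from choice[OF this] obtain a where a: "\<And>i k. i \<in> I \<Longrightarrow>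
      h i k = (\<Sum>x\<in>set zs. \<Sum>l<count_list zs x. a i x l * power_deriv l x k)"
    by blast
  have "(\<Sum>i\<in>I. c i * h i k)
      = (\<Sum>x\<in>set zs. \<Sum>l<count_list zs x. (\<Sum>i\<in>I. c i * a i x l) * power_deriv l x k)" for k
  proof -
    have "(\<Sum>i\<in>I. c i * h i k)
        = (\<Sum>i\<in>I. \<Sum>x\<in>set zs. \<Sum>l<count_list zs x. c i * a i x l * power_deriv l x k)"
      by (intro sum.cong refl) (simp add: a sum_distrib_left mult.assoc)
    also have "\<dots> = (\<Sum>x\<in>set zs. \<Sum>i\<in>I. \<Sum>l<count_list zs x. c i * a i x l * power_deriv l x k)"
      by (rule sum.swap)
    also have "\<dots> = (\<Sum>x\<in>set zs. \<Sum>l<count_list zs x. \<Sum>i\<in>I. c i * a i x l * power_deriv l x k)"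
      by (intro sum.cong refl sum.swap)
    finally show ?thesis by (simp add: sum_distrib_right)
  qed
  then show ?thesis unfolding power_deriv_span_def
    by (auto intro!: exI[of _ "\<lambda>x l. \<Sum>i\<in>I. c i * a i x l"])
qed

lemma power_deriv_span_add_scaled:
  assumes "g \<in> power_deriv_span zs" "h \<in> power_deriv_span zs"
  shows "(\<lambda>k. c * g k + e * h k) \<in> power_deriv_span zs"
proof -
  have "(\<lambda>k. \<Sum>b\<in>UNIV. (if b then c else e) * (if b then g else h) k) \<in> power_deriv_span zs"
    by (rule power_deriv_span_lincomb) (simp add: assms)
  then show ?thesis by (simp add: UNIV_bool add.commute)
qed

lemma power_deriv_in_span:
  assumes "l < count_list zs x"
  shows "power_deriv l x \<in> power_deriv_span zs"
proof -
  have x: "x \<in> set zs" using assms by (metis count_list_0_iff not_less0)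
  define a :: "complex \<Rightarrow> nat \<Rightarrow> complex" where "a y i = (if y = x \<and> i = l then 1 else 0)" for y i
  have inner: "(\<Sum>i<count_list zs y. a y i * power_deriv i y k) = (if y = x then power_deriv l x k else 0)"
    for y k
  proof (cases "y = x")
    case True
    have "a x i * power_deriv i x k = (if i = l then power_deriv l x k else 0)" for i
      by (auto simp: a_def)
    with True assms show ?thesis by simp
  qed (simp add: a_def)
  have "power_deriv l x k = (\<Sum>y\<in>set zs. \<Sum>i<count_list zs y. a y i * power_deriv i y k)" for k
    by (simp only: inner) (simp add: x)
  then show ?thesis unfolding power_deriv_span_def by blast
qed

text \<open>
  Solving \<open>(E - y) h = (d/dx)\<^sup>l x\<^sup>k\<close>. In the resonant case \<open>x = y\<close> the solution is the derivative of
  order \<open>l + 1\<close>, which the span contains because \<open>y\<close> has been added to the list. Otherwise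
  \<open>shift_minus_power_deriv\<close> is triangular in \<open>l\<close> with diagonal entry \<open>x - y \<noteq> 0\<close>.
\<close>

lemma shift_minus_onto_power_deriv:
  assumes "l < count_list zs x"
  shows "\<exists>h\<in>power_deriv_span (y # zs). \<forall>k. shift_minus y h k = power_deriv l x k"
proof (cases "x = y")
  case True
  let ?h = "\<lambda>k. inverse (of_nat (Suc l)) * power_deriv (Suc l) x k + 0 * power_deriv (Suc l) x k"
  have "?h \<in> power_deriv_span (y # zs)"
    using True assms by (intro power_deriv_span_add_scaled power_deriv_in_span) auto
  moreover have "shift_minus y ?h k = power_deriv l x k" for k
  proof -
    have "shift_minus y ?h k
        = inverse (of_nat (Suc l)) * shift_minus y (power_deriv (Suc l) x) k"
      by (simp add: shift_minus_def algebra_simps)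
    then show ?thesis
      unfolding shift_minus_power_deriv using True by (simp del: of_nat_Suc)
  qed
  ultimately show ?thesis by blast
next
  case False
  show ?thesis using assms
  proof (induction l)
    case 0
    let ?h = "\<lambda>k. inverse (x - y) * power_deriv 0 x k + 0 * power_deriv 0 x k"
    have "?h \<in> power_deriv_span (y # zs)"
      using 0 by (intro power_deriv_span_add_scaled power_deriv_in_span) auto
    moreover have "shift_minus y ?h k = power_deriv 0 x k" for k
    proof -
      have "shift_minus y ?h k = inverse (x - y) * shift_minus y (power_deriv 0 x) k"
        by (simp add: shift_minus_def algebra_simps)
      then show ?thesis unfolding shift_minus_power_deriv using False by simp
    qed
    ultimately show ?case by blast
  next
    case (Suc l)
    then obtain g where g: "g \<in> power_deriv_span (y # zs)"
      "\<And>k. shift_minus y g k = power_deriv l x k" by auto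
    let ?h = "\<lambda>k. inverse (x - y) * power_deriv (Suc l) x k + (- of_nat (Suc l) / (x - y)) * g k"
    have "?h \<in> power_deriv_span (y # zs)"
      using Suc g by (intro power_deriv_span_add_scaled power_deriv_in_span) auto
    moreover have "shift_minus y ?h k = power_deriv (Suc l) x k" for k
    proof -
      have "shift_minus y ?h k = inverse (x - y) * shift_minus y (power_deriv (Suc l) x) k
          + (- of_nat (Suc l) / (x - y)) * shift_minus y g k"
        by (simp add: shift_minus_def algebra_simps del: of_nat_Suc)
      also have "\<dots> = power_deriv (Suc l) x k"
      proof -
        have "inverse e * (e * p + c * q) + (- c / e) * q = p" if "e \<noteq> 0" for e p c q :: complex
          using that by (simp add: field_simps)
        note this[of "x - y" "power_deriv (Suc l) x k" "of_nat (Suc l)" "power_deriv l x k"]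
        then show ?thesis using False by (simp only: shift_minus_power_deriv g) simp
      qed
      finally show ?thesis .
    qed
    ultimately show ?case by blast
  qed
qed

lemma shift_minus_onto_span:
  assumes "g \<in> power_deriv_span zs"
  shows "\<exists>h\<in>power_deriv_span (y # zs). \<forall>k. shift_minus y h k = g k"
proof -
  obtain a where a: "\<And>k. g k = (\<Sum>x\<in>set zs. \<Sum>l<count_list zs x. a x l * power_deriv l x k)"
    using assms by (auto simp: power_deriv_span_def)
  let ?P = "SIGMA x:set zs. {..<count_list zs x}"
  have "\<forall>p. \<exists>h. p \<in> ?P \<longrightarrow> h \<in> power_deriv_span (y # zs) \<and>
      (\<forall>k. shift_minus y h k = power_deriv (snd p) (fst p) k)"
    using shift_minus_onto_power_deriv by fastforce
  from choice[OF this] obtain h where h: "\<And>p. p \<in> ?P \<Longrightarrow> h p \<in> power_deriv_span (y # zs)"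
    "\<And>p k. p \<in> ?P \<Longrightarrow> shift_minus y (h p) k = power_deriv (snd p) (fst p) k"
    by blast
  let ?H = "\<lambda>k. \<Sum>p\<in>?P. a (fst p) (snd p) * h p k"
  have "?H \<in> power_deriv_span (y # zs)"
    by (rule power_deriv_span_lincomb) (rule h)
  moreover have "shift_minus y ?H k = g k" for k
  proof -
    have "shift_minus y ?H k = (\<Sum>p\<in>?P. a (fst p) (snd p) * shift_minus y (h p) k)"
      using fold_shift_minus_lincomb[of "[y]" "\<lambda>p. a (fst p) (snd p)" h ?P k] by simp
    also have "\<dots> = (\<Sum>p\<in>?P. a (fst p) (snd p) * power_deriv (snd p) (fst p) k)"
      by (intro sum.cong refl) (simp only: h)
    also have "\<dots> = g k"
      by (simp add: a sum.Sigma case_prod_beta)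
    finally show ?thesis .
  qed
  ultimately show ?thesis by blast
qed

lemma shift_minus_kernel:
  assumes "\<And>k. k < N \<Longrightarrow> shift_minus y h k = 0" and "k \<le> N"
  shows "h k = h 0 * y ^ k"
  using assms(2)
proof (induction k)
  case (Suc k)
  then show ?case using assms(1)[of k] by (simp add: shift_minus_def algebra_simps)
qed simp

text \<open>
  The recurrence is known only on an initial segment, and each factor \<open>E - y\<close> shortens a segment
  by one; this is why \<open>N\<close> conditions control \<open>N + length zs\<close> entries. Undoing the factor \<open>E - y\<close>
  determines the sequence up to a multiple of its kernel \<open>k \<mapsto> y\<^sup>k\<close>, which is in the span.
\<close>

lemma annihilated_imp_span:
  assumes "\<And>k. k < N \<Longrightarrow> fold shift_minus zs m k = 0"
  shows "\<exists>h\<in>power_deriv_span zs. \<forall>k<N + length zs. m k = h k"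
  using assms
proof (induction zs arbitrary: m)
  case Nil
  then show ?case by (intro bexI[of _ "\<lambda>k. 0"]) (auto simp: power_deriv_span_def)
next
  case (Cons y zs)
  have "fold shift_minus zs (shift_minus y m) k = 0" if "k < N" for k
    using Cons.prems[OF that] by simp
  from Cons.IH[OF this] obtain g where g: "g \<in> power_deriv_span zs"
    "\<And>k. k < N + length zs \<Longrightarrow> shift_minus y m k = g k"
    by blast
  obtain h where h: "h \<in> power_deriv_span (y # zs)" "\<And>k. shift_minus y h k = g k"
    using shift_minus_onto_span[OF g(1), of y] by blast
  \<comment> \<open>The sequences \<open>m\<close> and \<open>h\<close> have the same image under \<open>E - y\<close>, so they differ by \<open>c y\<^sup>k\<close>.\<close>
  define c where "c = m 0 - h 0"
  have "m k - h k = c * y ^ k" if "k \<le> N + length zs" for k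
    unfolding c_def using that
  proof (rule shift_minus_kernel[where h = "\<lambda>k. m k - h k", rotated])
    fix k assume "k < N + length zs"
    have "shift_minus y (\<lambda>k. m k - h k) k = shift_minus y m k - shift_minus y h k"
      by (simp add: shift_minus_def algebra_simps)
    with g(2)[OF \<open>k < N + length zs\<close>] h(2) show "shift_minus y (\<lambda>k. m k - h k) k = 0"
      by (simp only: diff_self)
  qed
  then have "m k = 1 * h k + c * power_deriv 0 y k" if "k < N + length (y # zs)" for k
    using that by (simp add: power_deriv_def diff_eq_eq add.commute)
  moreover have "(\<lambda>k. 1 * h k + c * power_deriv 0 y k) \<in> power_deriv_span (y # zs)"
    using h by (intro power_deriv_span_add_scaled power_deriv_in_span) auto
  ultimately show ?case by (intro bexI allI impI)
qed

section \<open>Solvability as a closed condition\<close>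

text \<open>
  The representation by \<open>annihilated_imp_span\<close> may have zero leading coefficients or even nodes
  with no contribution. These are removed: the nodes kept are those with some nonzero
  coefficient, and the multiplicity becomes one plus the largest order that occurs.
\<close>

lemma prony_solvable_if_annihilated:
  assumes "length zs = d" and "\<And>k. k < d \<Longrightarrow> fold shift_minus zs \<mu> k = 0"
  shows "prony_solvable d \<mu>"
proof -
  obtain a where a: "\<And>k. k < 2 * d \<Longrightarrow>
      \<mu> k = (\<Sum>x\<in>set zs. \<Sum>l<count_list zs x. a x l * power_deriv l x k)"
    using annihilated_imp_span[of d zs \<mu>] assms by (auto simp: power_deriv_span_def mult_2)
  define L where "L x = {l. l < count_list zs x \<and> a x l \<noteq> 0}" for x
  define X where "X = {x \<in> set zs. L x \<noteq> {}}"
  define E where "E x = Suc (Max (L x))" for x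
  have [simp]: "finite (L x)" for x unfolding L_def by simp
  have "finite X" unfolding X_def by simp
  then obtain x where x: "bij_betw x {1..card X} X"
    using ex_bij_betw_nat_finite_1 by blast
  have Max: "Max (L y) \<in> L y" if "y \<in> X" for y using that by (auto simp: X_def)
  then have E_le: "E y \<le> count_list zs y" if "y \<in> X" for y
    using that by (auto simp: E_def L_def Suc_le_eq)
  have xX: "x j \<in> X" if "j \<in> {1..card X}" for j
    using x that by (auto dest: bij_betwE)
  have "(\<Sum>j=1..card X. E (x j)) = (\<Sum>y\<in>X. E y)"
    by (rule sum.reindex_bij_betw[OF x])
  also have "\<dots> \<le> (\<Sum>y\<in>X. count_list zs y)" by (intro sum_mono E_le)
  also have "\<dots> \<le> (\<Sum>y\<in>set zs. count_list zs y)" by (rule sum_mono2) (auto simp: X_def)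
  also have "\<dots> = d" using assms by (simp add: sum_count_set)
  finally have size: "(\<Sum>j=1..card X. E (x j)) \<le> d" .
  have moments: "prony_moment (card X) (\<lambda>j. E (x j)) x (\<lambda>j. a (x j)) k = \<mu> k" if "k < 2 * d" for k
  proof -
    have "prony_moment (card X) (\<lambda>j. E (x j)) x (\<lambda>j. a (x j)) k
        = (\<Sum>y\<in>X. \<Sum>l<E y. a y l * power_deriv l y k)"
      unfolding prony_moment_eq_sum_power_deriv
      by (rule sum.reindex_bij_betw[OF x, where g = "\<lambda>y. \<Sum>l<E y. a y l * power_deriv l y k"])
    also have "\<dots> = (\<Sum>y\<in>X. \<Sum>l<count_list zs y. a y l * power_deriv l y k)"
    proof (rule sum.cong[OF refl])
      fix y assume "y \<in> X"
      have "l \<notin> L y" if "E y \<le> l" for l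
      proof
        assume "l \<in> L y"
        then have "l \<le> Max (L y)" by (intro Max_ge) simp
        with that show False by (simp add: E_def)
      qed
      then show "(\<Sum>l<E y. a y l * power_deriv l y k)
          = (\<Sum>l<count_list zs y. a y l * power_deriv l y k)"
        using E_le[OF \<open>y \<in> X\<close>]
        by (intro sum.mono_neutral_left) (auto simp: L_def)
    qed
    also have "\<dots> = (\<Sum>y\<in>set zs. \<Sum>l<count_list zs y. a y l * power_deriv l y k)"
    proof (rule sum.mono_neutral_left)
      show "\<forall>y\<in>set zs - X. (\<Sum>l<count_list zs y. a y l * power_deriv l y k) = 0"
        by (auto simp: X_def L_def intro!: sum.neutral)
    qed (auto simp: X_def)
    finally show ?thesis using a that by simp
  qed
  have "prony_solution d \<mu> (card X) (\<lambda>j. E (x j)) x (\<lambda>j. a (x j))"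
    unfolding prony_solution_def
  proof (intro conjI ballI allI impI)
    show "inj_on x {1..card X}" using x by (rule bij_betw_imp_inj_on)
    show "a (x j) (E (x j) - 1) \<noteq> 0" if "j \<in> {1..card X}" for j
      using Max[OF xX[OF that]] by (simp add: E_def L_def)
  qed (use size moments in \<open>auto simp: E_def\<close>)
  then show ?thesis unfolding prony_solvable_def by blast
qed

text \<open>
  Equality of the moments with \<open>\<mu>\<close> holds only below \<open>2d\<close>, so the operator has to be evaluated
  from finitely many entries.
\<close>

lemma fold_shift_minus_local:
  assumes "\<And>i. i \<le> k + length zs \<Longrightarrow> m i = m' i"
  shows "fold shift_minus zs m k = fold shift_minus zs m' k"
  using assms
proof (induction zs arbitrary: m m')
  case (Cons y zs)
  show ?case by (simp, rule Cons.IH) (simp add: shift_minus_def Cons.prems)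
qed simp

lemma le_count_list_concat_replicate:
  assumes "j \<in> set js"
  shows "D j \<le> count_list (concat (map (\<lambda>i. replicate (D i) (x i)) js)) (x j)"
proof -
  have [simp]: "count_list (replicate n y) y = n" for n and y :: 'b
    by (induction n) auto
  show ?thesis using assms by (induction js) (auto intro: le_SucI trans_le_add2)
qed

text \<open>
  The multiplicities of a solution may add up to less than \<open>d\<close>. The zeros that fill the list up to length
  \<open>d\<close> do no harm: further factors preserve the annihilation, and the entries remain bounded by
  the largest node modulus.
\<close>

lemma prony_solution_annihilated:
  assumes "prony_solution d \<mu> s D x a"
  shows "\<exists>zs. length zs = d \<and> set zs \<subseteq> insert 0 (x ` {1..s}) \<and>
    (\<forall>k<d. fold shift_minus zs \<mu> k = 0)"
proof -
  define ns where "ns = concat (map (\<lambda>j. replicate (D j) (x j)) [1..<Suc s])"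
  define zs where "zs = ns @ replicate (d - length ns) 0"
  have "length ns = (\<Sum>j=1..s. D j)"
    by (simp add: ns_def length_concat comp_def interv_sum_list_conv_sum_set_nat
        atLeastLessThanSuc_atLeastAtMost del: upt_Suc)
  then have len: "length zs = d"
    using assms by (simp add: zs_def prony_solution_def)
  have nodes: "set zs \<subseteq> insert 0 (x ` {1..s})"
    by (auto simp: zs_def ns_def)
  have count: "D j \<le> count_list zs (x j)" if "j \<in> {1..s}" for j
    using that le_count_list_concat_replicate[of j "[1..<Suc s]" D x]
    by (simp add: zs_def ns_def trans_le_add1 del: upt_Suc)
  have "fold shift_minus zs \<mu> k = 0" if "k < d" for k
  proof -
    have "fold shift_minus zs \<mu> k
        = fold shift_minus zs (\<lambda>k. \<Sum>j=1..s. 1 * (\<Sum>l<D j. a j l * power_deriv l (x j) k)) k"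
    proof (rule fold_shift_minus_local)
      fix i assume "i \<le> k + length zs"
      then have "\<mu> i = prony_moment s D x a i"
        using assms len that by (simp add: prony_solution_def)
      then show "\<mu> i = (\<Sum>j=1..s. 1 * (\<Sum>l<D j. a j l * power_deriv l (x j) i))"
        by (simp add: prony_moment_eq_sum_power_deriv)
    qed
    also have "\<dots> = (\<Sum>j=1..s. \<Sum>l<D j. a j l * fold shift_minus zs (power_deriv l (x j)) k)"
      by (simp only: fold_shift_minus_lincomb) simp
    also have "\<dots> = 0"
      using count by (intro sum.neutral ballI) (simp add: fold_shift_minus_power_deriv_eq_0 order_less_le_trans)
    finally show ?thesis .
  qed
  with len nodes show ?thesis by blast
qed

section \<open>Passing to the limit with bounded nodes\<close>

lemma tendsto_fold_shift_minus:
  assumes "\<And>k. (\<lambda>n. m n k) \<longlonglongrightarrow> m' k" and "\<And>i. (\<lambda>n. z n i) \<longlonglongrightarrow> z' i"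
  shows "(\<lambda>n. fold shift_minus (map (z n) is) (m n) k) \<longlonglongrightarrow> fold shift_minus (map z' is) m' k"
  using assms(1)
proof (induction "is" arbitrary: m m')
  case (Cons i "is")
  have "(\<lambda>n. shift_minus (z n i) (m n) k) \<longlonglongrightarrow> shift_minus (z' i) m' k" for k
    unfolding shift_minus_def by (intro tendsto_intros Cons.prems assms(2))
  then show ?case using Cons.IH by simp
qed simp

text \<open>
  Tychonoff's theorem for a product of discs; the product is sequentially compact because
  the index set is countable.
\<close>

lemma bounded_nodes_convergent_subsequence:
  fixes z :: "nat \<Rightarrow> nat \<Rightarrow> complex"
  assumes "\<And>n i. norm (z n i) \<le> B"
  shows "\<exists>z' r. strict_mono r \<and> (\<forall>i. (\<lambda>n. z (r n) i) \<longlonglongrightarrow> z' i)"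
proof -
  have "compactin (product_topology (\<lambda>i. euclidean) UNIV) (PiE UNIV (\<lambda>i::nat. cball (0::complex) B))"
    by (simp add: compactin_PiE)
  then have "compact (PiE UNIV (\<lambda>i::nat. cball (0::complex) B))"
    by (simp add: euclidean_product_topology)
  then have "seq_compact (PiE UNIV (\<lambda>i::nat. cball (0::complex) B))"
    by (rule compact_imp_seq_compact)
  moreover have "\<forall>n. z n \<in> PiE UNIV (\<lambda>i. cball 0 B)" using assms by auto
  ultimately obtain z' r where r: "strict_mono r" and lim: "(z \<circ> r) \<longlonglongrightarrow> z'"
    unfolding seq_compact_def by blast
  have "(\<lambda>n. z (r n) i) \<longlonglongrightarrow> z' i" for i
    using lim continuous_on_tendsto_compose[OF continuous_on_product_coordinates[of i] lim] by simp
  with r show ?thesis by blast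
qed

text \<open>
  Nodes may merge and coefficients may blow up along the sequence, so one cannot pass to the limit in
  the solutions themselves; the annihilating lists of nodes do converge along a subsequence.
\<close>

lemma limit_of_bounded_nodes_solvable:
  assumes lim: "f \<longlonglongrightarrow> \<mu>"
    and sol: "\<And>n. \<exists>s D x a. prony_solution d (f n) s D x a \<and> max_node_norm s x \<le> B"
  shows "prony_solvable d \<mu>"
proof -
  have "\<exists>zs. length zs = d \<and> (\<forall>w\<in>set zs. norm w \<le> B) \<and>
      (\<forall>k<d. fold shift_minus zs (f n) k = 0)" for n
  proof -
    obtain s D x a where sol_n: "prony_solution d (f n) s D x a" and bound: "max_node_norm s x \<le> B"
      using sol by blast
    have "norm w \<le> B" if "w \<in> insert 0 (x ` {1..s})" for w
    proof -
      have "norm w \<in> insert 0 ((\<lambda>j. norm (x j)) ` {1..s})" using that by auto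
      then have "norm w \<le> max_node_norm s x"
        unfolding max_node_norm_def by (intro Max_ge) auto
      with bound show ?thesis by linarith
    qed
    then show ?thesis
      using prony_solution_annihilated[OF sol_n] by blast
  qed
  then have "\<forall>n. \<exists>zs. length zs = d \<and> (\<forall>w\<in>set zs. norm w \<le> B) \<and>
      (\<forall>k<d. fold shift_minus zs (f n) k = 0)" by blast
  from choice[OF this] obtain zs where zs: "\<And>n. length (zs n) = d"
    "\<And>n w. w \<in> set (zs n) \<Longrightarrow> norm w \<le> B"
    "\<And>n k. k < d \<Longrightarrow> fold shift_minus (zs n) (f n) k = 0"
    by blast
  \<comment> \<open>Lists of length \<open>d\<close> become sequences, to which compactness of a product applies.\<close>
  define z where "z n i = (if i < d then zs n ! i else 0)" for n i
  have "norm (z n i) \<le> max 0 B" for n i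
  proof (cases "i < d")
    case True
    then have "z n i \<in> set (zs n)" using zs(1)[of n] by (simp add: z_def)
    then show ?thesis using zs(2) by fastforce
  qed (simp add: z_def)
  then obtain z' r where r: "strict_mono r" and z': "\<And>i. (\<lambda>n. z (r n) i) \<longlonglongrightarrow> z' i"
    using bounded_nodes_convergent_subsequence by blast
  have map_z: "map (z n) [0..<d] = zs n" for n
    using zs(1)[of n] by (simp add: list_eq_iff_nth_eq z_def)
  have coord: "(\<lambda>n. f (r n) k) \<longlonglongrightarrow> \<mu> k" for k
    using continuous_on_tendsto_compose[OF continuous_on_product_coordinates[of k]
        LIMSEQ_subseq_LIMSEQ[OF lim r]] by simp
  have "fold shift_minus (map z' [0..<d]) \<mu> k = 0" if "k < d" for k
  proof -
    have "(\<lambda>n. fold shift_minus (map (z (r n)) [0..<d]) (f (r n)) k)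
        \<longlonglongrightarrow> fold shift_minus (map z' [0..<d]) \<mu> k"
      using coord z' by (rule tendsto_fold_shift_minus)
    then show ?thesis
      using that by (simp add: map_z zs(3) LIMSEQ_const_iff)
  qed
  then show ?thesis by (intro prony_solvable_if_annihilated[of "map z' [0..<d]"]) auto
qed

section \<open>Unboundedness of the nodes near unsolvable right-hand sides\<close>

theorem theorem5:
  fixes d :: nat and \<mu>0 :: "nat \<Rightarrow> complex" and R :: "(nat \<Rightarrow> complex) \<Rightarrow> real"
  assumes "d \<ge> 1"
    and "\<mu>0 \<in> prony_unsolvable_set d"
    and "is_prony_max_node_norm d R"
  shows "filterlim R at_top (at \<mu>0 within (prony_rhs d - prony_unsolvable_set d))"
proof -
  let ?S = "prony_rhs d - prony_unsolvable_set d"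
  have "eventually (\<lambda>\<mu>. B \<le> R \<mu>) (at \<mu>0 within ?S)" for B
  proof (rule ccontr)
    assume "\<not> eventually (\<lambda>\<mu>. B \<le> R \<mu>) (at \<mu>0 within ?S)"
    then have "\<mu>0 islimpt (?S \<inter> {\<mu>. R \<mu> < B})"
      unfolding islimpt_def eventually_at_topological by (metis IntI mem_Collect_eq not_le)
    then obtain f where f: "\<And>n. f n \<in> ?S \<inter> {\<mu>. R \<mu> < B}" and lim: "f \<longlonglongrightarrow> \<mu>0"
      unfolding islimpt_sequential by blast
    have "\<exists>s D x a. prony_solution d (f n) s D x a \<and> max_node_norm s x \<le> B" for n
    proof -
      have "f n \<in> ?S" and "R (f n) < B" using f[of n] by auto
      then obtain s D x a where "prony_solution d (f n) s D x a" "R (f n) = max_node_norm s x"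
        using assms(3) unfolding is_prony_max_node_norm_def by blast
      with \<open>R (f n) < B\<close> have "prony_solution d (f n) s D x a \<and> max_node_norm s x \<le> B"
        by simp
      then show ?thesis by blast
    qed
    with lim have "prony_solvable d \<mu>0" by (rule limit_of_bounded_nodes_solvable)
    with assms(2) show False by (simp add: prony_unsolvable_set_def)
  qed
  then show ?thesis by (simp add: filterlim_at_top)
qed

end
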